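(* Let $G$ be a non-trivial nilpotent group, let $A$ be a non-trivial abelian group with trivial $G$-module structure, and let $\delta \in Z^2(G,A)$. Then the extension $E_\delta$ of $A$ by $G$ via $\delta$ is a lower central series extension if and only if the homomorphism $\kappa(\delta) : M(G,\lambda(G)) \to A$ is surjective.
   Context: $G$ is written multiplicatively and $A$ additively. $Z^2(G,A)$ is the group of normalized 2-cocycles $\delta : G\times G\to A$ (trivial action): $\delta(g,h)+\delta(gh,k)=\delta(h,k)+\delta(g,hk)$ and $\delta(g,1)=\delta(1,g)=0$ for all $g,h,k\in G$. The extension $E_\delta$ of $A$ by $G$ via $\delta$ is the set $G\times A$ with multiplication $(g,a)(g',a')=(gg',a+a'+\delta(g,g'))$; $A$ embeds via $a\mapsto(1,a)$ with image $\overline{A}=\{(1,a)\mid a\in A\}$, and $E_\delta$ projects onto $G$ via $(g,a)\mapsto g$. An extension $E$ of $A$ by $G$, with image $\overline{A}$ of $A$ in $E$, is a lower central series extension if $E$ is nilpotent and $\overline{A}$ equals the smallest non-trivial term of the lower central series of $E$. For a non-trivial nilpotent group $G$, $\lambda(G)$ denotes the smallest non-trivial term of the lower central series of $G$; it is contained in the center $Z(G)$. Write ${}^h g=hgh^{-1}$. For $H\le G$, central or normal, the non-abelian exterior product $G\wedge H$ is the group generated by the symbols $g\wedge h$ ($g\in G$, $h\in H$) subject to the relations $gg'\wedge h=({}^g g'\wedge {}^g h)(g\wedge h)$, $g\wedge hh'=(g\wedge h)({}^h g\wedge {}^h h')$ for $g,g'\in G$, $h,h'\in H$, and $h\wedge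 h=1$ for $h\in H$. The Schur multiplier $M(G,H)$ of the pair $(G,H)$ is the kernel of the homomorphism $G\wedge H\to[G,H]$, $g\wedge h\mapsto ghg^{-1}h^{-1}$. If $H\le Z(G)$, then $M(G,H)=G\wedge H$. For $\delta\in Z^2(G,A)$ put $\hat\delta(g,h)=\delta(g,h)-\delta(h,g)-\delta((hg)^{-1},hg)+\delta((hg)^{-1},gh)$; if $h\in Z(G)$ this equals $\delta(g,h)-\delta(h,g)$. The map $\kappa(\delta): M(G,\lambda(G))\to A$ is the group homomorphism determined by $g\wedge h\mapsto\hat\delta(g,h)$ for $g\in G$, $h\in\lambda(G)$ (it is well defined). *)

theory Defs
  imports "HOL-Algebra.Generated_Groups" "HOL-Algebra.Coset"
begin

text \<open>
  All groups, including the coefficient group \<open>A\<close>, are multiplicative group records;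
  so \<open>a + b\<close> and \<open>- a\<close> in \<open>A\<close> read
  \<open>a \<otimes>\<^bsub>A\<^esub> b\<close> and \<open>inv\<^bsub>A\<^esub> a\<close>.
\<close>

definition commutator :: "('a, 'm) monoid_scheme \<Rightarrow> 'a \<Rightarrow> 'a \<Rightarrow> 'a" where
  "commutator G g h = g \<otimes>\<^bsub>G\<^esub> h \<otimes>\<^bsub>G\<^esub> inv\<^bsub>G\<^esub> g \<otimes>\<^bsub>G\<^esub> inv\<^bsub>G\<^esub> h"

definition commutator_subgroup :: "('a, 'm) monoid_scheme \<Rightarrow> 'a set \<Rightarrow> 'a set \<Rightarrow> 'a set" where
  "commutator_subgroup G H K = generate G {commutator G h k | h k. h \<in> H \<and> k \<in> K}"

text \<open>The index is shifted: \<open>lower_central_series G n\<close> is the term usually written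
  \<open>\<gamma>\<close> with index \<open>n + 1\<close>.\<close>

primrec lower_central_series :: "('a, 'm) monoid_scheme \<Rightarrow> nat \<Rightarrow> 'a set" where
  "lower_central_series G 0 = carrier G"
| "lower_central_series G (Suc n) = commutator_subgroup G (carrier G) (lower_central_series G n)"

definition nilpotent_group :: "('a, 'm) monoid_scheme \<Rightarrow> bool" where
  "nilpotent_group G \<longleftrightarrow> group G \<and> (\<exists>n. lower_central_series G n = {\<one>\<^bsub>G\<^esub>})"

definition is_last_lcs_term :: "('a, 'm) monoid_scheme \<Rightarrow> 'a set \<Rightarrow> bool" where
  "is_last_lcs_term G H \<longleftrightarrow>
     H \<in> range (lower_central_series G) \<and> H \<noteq> {\<one>\<^bsub>G\<^esub>} \<and>
     (\<forall>K \<in> range (lower_central_series G). K \<noteq> {\<one>\<^bsub>G\<^esub>} \<longrightarrow> H \<subseteq> K)"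

text \<open>Meaningful for non-trivial nilpotent \<open>G\<close>.\<close>

definition last_lcs_term :: "('a, 'm) monoid_scheme \<Rightarrow> 'a set" where
  "last_lcs_term G = (THE H. is_last_lcs_term G H)"


text \<open>Cocycles are unconstrained outside \<open>carrier G\<close>.\<close>

definition cocycles2 ::
  "('a, 'm) monoid_scheme \<Rightarrow> ('b, 'n) monoid_scheme \<Rightarrow> ('a \<Rightarrow> 'a \<Rightarrow> 'b) set" where
  "cocycles2 G A = {\<delta>.
     (\<forall>g \<in> carrier G. \<forall>h \<in> carrier G. \<delta> g h \<in> carrier A) \<and>
     (\<forall>g \<in> carrier G. \<forall>h \<in> carrier G. \<forall>k \<in> carrier G.
        \<delta> g h \<otimes>\<^bsub>A\<^esub> \<delta> (g \<otimes>\<^bsub>G\<^esub> h) k = \<delta> h k \<otimes>\<^bsub>A\<^esub> \<delta> g (h \<otimes>\<^bsub>G\<^esub> k)) \<and>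
     (\<forall>g \<in> carrier G. \<delta> g \<one>\<^bsub>G\<^esub> = \<one>\<^bsub>A\<^esub> \<and> \<delta> \<one>\<^bsub>G\<^esub> g = \<one>\<^bsub>A\<^esub>)}"

definition cocycle_extension ::
  "('a, 'm) monoid_scheme \<Rightarrow> ('b, 'n) monoid_scheme \<Rightarrow> ('a \<Rightarrow> 'a \<Rightarrow> 'b) \<Rightarrow> ('a \<times> 'b) monoid" where
  "cocycle_extension G A \<delta> =
     \<lparr> carrier = carrier G \<times> carrier A,
       mult = (\<lambda>(g, a) (g', a'). (g \<otimes>\<^bsub>G\<^esub> g', a \<otimes>\<^bsub>A\<^esub> a' \<otimes>\<^bsub>A\<^esub> \<delta> g g')),
       one = (\<one>\<^bsub>G\<^esub>, \<one>\<^bsub>A\<^esub>) \<rparr>"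

definition coefficient_image ::
  "('a, 'm) monoid_scheme \<Rightarrow> ('b, 'n) monoid_scheme \<Rightarrow> ('a \<times> 'b) set" where
  "coefficient_image G A = {(\<one>\<^bsub>G\<^esub>, a) | a. a \<in> carrier A}"

text \<open>Here \<open>N\<close> is the image of the kernel group in the extension group \<open>E\<close>.\<close>

definition lcs_extension :: "('e, 'm) monoid_scheme \<Rightarrow> 'e set \<Rightarrow> bool" where
  "lcs_extension E N \<longleftrightarrow> nilpotent_group E \<and> is_last_lcs_term E N"


text \<open>A letter \<open>(x, True)\<close> stands for the generator \<open>x\<close> and \<open>(x, False)\<close> for its inverse.
  A relation \<open>r = s\<close> is given as the pair \<open>(r, s)\<close> of words.\<close>

type_synonym 'x word = "('x \<times> bool) list"

inductive word_equiv :: "'x set \<Rightarrow> ('x word \<times> 'x word) set \<Rightarrow> 'x word \<Rightarrow> 'x word \<Rightarrow> bool"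
  for X R where
  refl: "word_equiv X R w w"
| sym: "word_equiv X R v w \<Longrightarrow> word_equiv X R w v"
| trans: "word_equiv X R u v \<Longrightarrow> word_equiv X R v w \<Longrightarrow> word_equiv X R u w"
| cancel: "x \<in> X \<Longrightarrow> word_equiv X R (u @ [(x, b), (x, \<not> b)] @ v) (u @ v)"
| relation: "(r, s) \<in> R \<Longrightarrow> word_equiv X R (u @ r @ v) (u @ s @ v)"

definition word_rel :: "'x set \<Rightarrow> ('x word \<times> 'x word) set \<Rightarrow> ('x word \<times> 'x word) set" where
  "word_rel X R = {(v, w). v \<in> lists (X \<times> UNIV) \<and> w \<in> lists (X \<times> UNIV) \<and> word_equiv X R v w}"

definition presented_group :: "'x set \<Rightarrow> ('x word \<times> 'x word) set \<Rightarrow> 'x word set monoid" where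
  "presented_group X R =
     \<lparr> carrier = lists (X \<times> UNIV) // word_rel X R,
       mult = (\<lambda>C D. \<Union>u \<in> C. \<Union>v \<in> D. word_rel X R `` {u @ v}),
       one = word_rel X R `` {[]} \<rparr>"

definition presented_gen :: "'x set \<Rightarrow> ('x word \<times> 'x word) set \<Rightarrow> 'x \<Rightarrow> 'x word set" where
  "presented_gen X R x = word_rel X R `` {[(x, True)]}"


definition conjugate :: "('a, 'm) monoid_scheme \<Rightarrow> 'a \<Rightarrow> 'a \<Rightarrow> 'a" where
  "conjugate G h g = h \<otimes>\<^bsub>G\<^esub> g \<otimes>\<^bsub>G\<^esub> inv\<^bsub>G\<^esub> h"

text \<open>Here \<open>H\<close> is meant to be a normal subgroup of \<open>G\<close>, so that the conjugates of its
  elements occurring in the relations lie in \<open>H\<close>; central subgroups are normal.\<close>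

definition exterior_rels ::
  "('a, 'm) monoid_scheme \<Rightarrow> 'a set \<Rightarrow> (('a \<times> 'a) word \<times> ('a \<times> 'a) word) set" where
  "exterior_rels G H =
     {([((g \<otimes>\<^bsub>G\<^esub> g', h), True)],
       [((conjugate G g g', conjugate G g h), True), ((g, h), True)])
      | g g' h. g \<in> carrier G \<and> g' \<in> carrier G \<and> h \<in> H} \<union>
     {([((g, h \<otimes>\<^bsub>G\<^esub> h'), True)],
       [((g, h), True), ((conjugate G h g, conjugate G h h'), True)])
      | g h h'. g \<in> carrier G \<and> h \<in> H \<and> h' \<in> H} \<union>
     {([((h, h), True)], []) | h. h \<in> H}"

definition exterior_product ::
  "('a, 'm) monoid_scheme \<Rightarrow> 'a set \<Rightarrow> ('a \<times> 'a) word set monoid" where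
  "exterior_product G H = presented_group (carrier G \<times> H) (exterior_rels G H)"

definition wedge :: "('a, 'm) monoid_scheme \<Rightarrow> 'a set \<Rightarrow> 'a \<Rightarrow> 'a \<Rightarrow> ('a \<times> 'a) word set" where
  "wedge G H g h = presented_gen (carrier G \<times> H) (exterior_rels G H) (g, h)"

definition wedge_commutator_map ::
  "('a, 'm) monoid_scheme \<Rightarrow> 'a set \<Rightarrow> ('a \<times> 'a) word set \<Rightarrow> 'a" where
  "wedge_commutator_map G H = (THE \<phi>.
     \<phi> \<in> hom (exterior_product G H) (G\<lparr>carrier := commutator_subgroup G (carrier G) H\<rparr>) \<and>
     \<phi> \<in> extensional (carrier (exterior_product G H)) \<and>
     (\<forall>g \<in> carrier G. \<forall>h \<in> H. \<phi> (wedge G H g h) = commutator G g h))"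

definition schur_multiplier_pair ::
  "('a, 'm) monoid_scheme \<Rightarrow> 'a set \<Rightarrow> ('a \<times> 'a) word set monoid" where
  "schur_multiplier_pair G H = (exterior_product G H)
     \<lparr>carrier := kernel (exterior_product G H)
        (G\<lparr>carrier := commutator_subgroup G (carrier G) H\<rparr>) (wedge_commutator_map G H)\<rparr>"


definition cocycle_hat ::
  "('a, 'm) monoid_scheme \<Rightarrow> ('b, 'n) monoid_scheme \<Rightarrow> ('a \<Rightarrow> 'a \<Rightarrow> 'b) \<Rightarrow> 'a \<Rightarrow> 'a \<Rightarrow> 'b" where
  "cocycle_hat G A \<delta> g h =
     \<delta> g h \<otimes>\<^bsub>A\<^esub> inv\<^bsub>A\<^esub> (\<delta> h g)
       \<otimes>\<^bsub>A\<^esub> inv\<^bsub>A\<^esub> (\<delta> (inv\<^bsub>G\<^esub> (h \<otimes>\<^bsub>G\<^esub> g)) (h \<otimes>\<^bsub>G\<^esub> g))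
       \<otimes>\<^bsub>A\<^esub> \<delta> (inv\<^bsub>G\<^esub> (h \<otimes>\<^bsub>G\<^esub> g)) (g \<otimes>\<^bsub>G\<^esub> h)"

text \<open>For non-trivial nilpotent \<open>G\<close> the subgroup \<open>last_lcs_term G\<close> is central, so the
  multiplier is the whole exterior product and its wedges generate it; hence the
  description below determines the homomorphism. Extensionality only fixes the values
  outside the carrier.\<close>

definition kappa ::
  "('a, 'm) monoid_scheme \<Rightarrow> ('b, 'n) monoid_scheme \<Rightarrow> ('a \<Rightarrow> 'a \<Rightarrow> 'b)
     \<Rightarrow> ('a \<times> 'a) word set \<Rightarrow> 'b" where
  "kappa G A \<delta> = (THE \<phi>.
     \<phi> \<in> hom (schur_multiplier_pair G (last_lcs_term G)) A \<and>
     \<phi> \<in> extensional (carrier (schur_multiplier_pair G (last_lcs_term G))) \<and>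
     (\<forall>g \<in> carrier G. \<forall>h \<in> last_lcs_term G.
        \<phi> (wedge G (last_lcs_term G) g h) = cocycle_hat G A \<delta> g h))"

end

(* Let c be the index of the last non-trivial lower central term of G, and let E be the extension
   with its projection onto G.  The projection maps the c-th term of E onto lambda(G), so the next
   term of E lies over 1; it is generated by the commutators of arbitrary elements of E with lifts
   of elements h of the central subgroup lambda(G).  Such a commutator is
   (1, delta(g,h) - delta(h,g)), independently of the chosen lifts.  Hence this term is the copy of
   the image of kappa(delta) in the coefficient group, and as it is central the following term is
   trivial.  So the image of A is the last non-trivial term of E iff kappa(delta) is onto. *)

theory Submission
  imports Defs
begin

subsection \<open>Homomorphisms from presented groups\<close>

lemma word_equiv_context:
  "word_equiv X R v w \<Longrightarrow> word_equiv X R (p @ v @ q) (p @ w @ q)"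
proof (induction rule: word_equiv.induct)
  case (cancel x u b v)
  then show ?case
    \<comment> \<open>The elementary rules already allow an arbitrary context, which absorbs
      \<open>p\<close> and \<open>q\<close>.\<close>
    using word_equiv.cancel[of x X R "p @ u" b "v @ q"] by simp
next
  case (relation r s u v)
  then show ?case
    using word_equiv.relation[of r s R X "p @ u" "v @ q"] by simp
qed (blast intro: word_equiv.intros)+

lemma word_equiv_append:
  assumes "word_equiv X R u u'" "word_equiv X R v v'"
  shows "word_equiv X R (u @ v) (u' @ v')"
  using word_equiv_context[OF assms(1), of "[]" v] word_equiv_context[OF assms(2), of u' "[]"]
  by (auto intro: word_equiv.trans)

lemma equiv_word_rel: "equiv (lists (X \<times> UNIV)) (word_rel X R)"
  by (rule equivI)
     (auto simp: word_rel_def refl_on_def sym_def trans_def intro: word_equiv.intros)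

lemma presented_carrier_eq:
  "carrier (presented_group X R) = (\<lambda>w. word_rel X R `` {w}) ` lists (X \<times> UNIV)"
  by (auto simp: presented_group_def quotient_def)

lemma presented_carrierE:
  assumes "C \<in> carrier (presented_group X R)"
  obtains w where "w \<in> lists (X \<times> UNIV)" "C = word_rel X R `` {w}"
  using assms unfolding presented_carrier_eq by blast

text \<open>Concatenation respects word equivalence, so the union over all representatives in the
  definition of the product collapses to a single class.\<close>

lemma presented_mult_class:
  assumes "u \<in> lists (X \<times> UNIV)" "v \<in> lists (X \<times> UNIV)"
  shows "word_rel X R `` {u} \<otimes>\<^bsub>presented_group X R\<^esub> word_rel X R `` {v} = word_rel X R `` {u @ v}"
proof -
  have "congruent2 (word_rel X R) (word_rel X R) (\<lambda>u v. word_rel X R `` {u @ v})"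
  proof (rule congruent2I')
    fix u u' v v' assume "(u, u') \<in> word_rel X R" "(v, v') \<in> word_rel X R"
    then have "(u @ v, u' @ v') \<in> word_rel X R"
      by (auto simp: word_rel_def intro: word_equiv_append)
    then show "word_rel X R `` {u @ v} = word_rel X R `` {u' @ v'}"
      by (rule equiv_class_eq[OF equiv_word_rel])
  qed
  then show ?thesis
    using UN_equiv_class2[OF equiv_word_rel equiv_word_rel _ assms]
    by (simp add: presented_group_def)
qed

lemma presented_mult_closed:
  assumes "C \<in> carrier (presented_group X R)" "D \<in> carrier (presented_group X R)"
  shows "C \<otimes>\<^bsub>presented_group X R\<^esub> D \<in> carrier (presented_group X R)"
proof -
  obtain v w where "v @ w \<in> lists (X \<times> UNIV)"
    "C \<otimes>\<^bsub>presented_group X R\<^esub> D = word_rel X R `` {v @ w}"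
    by (metis assms presented_carrierE presented_mult_class append_in_lists_conv)
  then show ?thesis unfolding presented_carrier_eq by blast
qed

lemma presented_gen_in_carrier:
  "x \<in> X \<Longrightarrow> presented_gen X R x \<in> carrier (presented_group X R)"
  by (auto simp: presented_carrier_eq presented_gen_def)

text \<open>This single cancellation later forces the value of a homomorphism on an inverse letter,
  working only with products of classes.\<close>

lemma presented_inverse_letter:
  assumes "x \<in> X"
  shows "presented_gen X R x \<otimes>\<^bsub>presented_group X R\<^esub> word_rel X R `` {[(x, False)]}
    = word_rel X R `` {[]}"
proof -
  have "([(x, True), (x, False)], []) \<in> word_rel X R"
    using assms word_equiv.cancel[of x X R "[]" True "[]"] by (simp add: word_rel_def)
  then show ?thesis
    using assms equiv_class_eq[OF equiv_word_rel]
    by (simp add: presented_gen_def presented_mult_class)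
qed

section \<open>Evaluation of words and the universal property of a presentation\<close>

definition eval_letter :: "('k, 'm) monoid_scheme \<Rightarrow> ('x \<Rightarrow> 'k) \<Rightarrow> 'x \<times> bool \<Rightarrow> 'k" where
  "eval_letter K f l = (if snd l then f (fst l) else inv\<^bsub>K\<^esub> f (fst l))"

definition eval_word :: "('k, 'm) monoid_scheme \<Rightarrow> ('x \<Rightarrow> 'k) \<Rightarrow> 'x word \<Rightarrow> 'k" where
  "eval_word K f w = foldr (\<lambda>l k. eval_letter K f l \<otimes>\<^bsub>K\<^esub> k) w \<one>\<^bsub>K\<^esub>"

context group
begin

lemma eval_letter_closed: "range f \<subseteq> carrier G \<Longrightarrow> eval_letter G f l \<in> carrier G"
  by (auto simp: eval_letter_def)

lemma eval_word_closed: "range f \<subseteq> carrier G \<Longrightarrow> eval_word G f w \<in> carrier G"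
  by (induction w) (auto simp: eval_word_def eval_letter_closed)

lemma eval_word_append:
  "range f \<subseteq> carrier G \<Longrightarrow> eval_word G f (v @ w) = eval_word G f v \<otimes> eval_word G f w"
proof (induction v)
  case Nil
  then show ?case using eval_word_closed[of f w] by (simp add: eval_word_def)
next
  case (Cons l v)
  then show ?case
    using eval_word_closed[of f w] eval_word_closed[of f v] eval_letter_closed[of f l]
    by (simp add: eval_word_def m_assoc)
qed

text \<open>The map is evaluated on all letters, not only those over \<open>X\<close>, because a derivation of
  \<open>word_equiv\<close> may pass through words with letters outside \<open>X\<close>.\<close>

lemma eval_word_equiv:
  assumes "word_equiv X R v w" and f: "range f \<subseteq> carrier G"
    and R: "\<And>r s. (r, s) \<in> R \<Longrightarrow> eval_word G f r = eval_word G f s"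
  shows "eval_word G f v = eval_word G f w"
  using assms(1)
proof (induction rule: word_equiv.induct)
  case (cancel x u b v)
  have "f x \<in> carrier G" using f by auto
  then have "eval_word G f [(x, b), (x, \<not> b)] = \<one>"
    by (cases b) (simp_all add: eval_word_def eval_letter_def)
  then show ?case
    using eval_word_closed[OF f]
    unfolding eval_word_append[OF f] by (simp only: l_one)
next
  case (relation r s u v)
  then show ?case by (simp add: eval_word_append[OF f] R)
qed simp_all

text \<open>Von Dyck's theorem: evaluation of words is constant on classes as soon as both sides of
  each relation have equal values.\<close>

lemma presented_group_hom_exists:
  assumes f: "f \<in> X \<rightarrow> carrier G"
    and R: "\<And>r s. (r, s) \<in> R \<Longrightarrow> r \<in> lists (X \<times> UNIV) \<and> s \<in> lists (X \<times> UNIV) \<and>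
      eval_word G f r = eval_word G f s"
  obtains \<phi> where "\<phi> \<in> hom (presented_group X R) G"
    and "\<phi> \<in> extensional (carrier (presented_group X R))"
    and "\<And>x. x \<in> X \<Longrightarrow> \<phi> (presented_gen X R x) = f x"
proof
  \<comment> \<open>The default value \<open>\<one>\<close> off \<open>X\<close> puts the whole
    range into the carrier, as evaluation along a derivation of \<open>word_equiv\<close> demands;
    words over \<open>X\<close> keep their values.\<close>
  define f' where "f' x = (if x \<in> X then f x else \<one>)" for x
  define \<phi> where "\<phi> = (\<lambda>C \<in> carrier (presented_group X R). eval_word G f' (SOME w. w \<in> C))"
  have f': "range f' \<subseteq> carrier G" using f by (auto simp: f'_def)
  have eval_eq: "eval_word G f' w = eval_word G f w" if "w \<in> lists (X \<times> UNIV)" for w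
    using that by (induction w) (auto simp: eval_word_def eval_letter_def f'_def)
  have R': "eval_word G f' r = eval_word G f' s" if "(r, s) \<in> R" for r s
    using R[OF that] by (simp add: eval_eq)
  have \<phi>_class: "\<phi> (word_rel X R `` {w}) = eval_word G f' w" if w: "w \<in> lists (X \<times> UNIV)" for w
  proof -
    \<comment> \<open>The class is inhabited, so the representative picked by \<open>SOME\<close> is
      equivalent to \<open>w\<close> and has the same value.\<close>
    have "w \<in> word_rel X R `` {w}"
      using equiv_class_self[OF equiv_word_rel w] .
    then have "(SOME v. v \<in> word_rel X R `` {w}) \<in> word_rel X R `` {w}"
      by (rule someI)
    then have "word_equiv X R w (SOME v. v \<in> word_rel X R `` {w})"
      unfolding Image_singleton_iff by (auto simp only: word_rel_def)
    then show ?thesis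
      using w eval_word_equiv[OF _ f' R'] by (auto simp: \<phi>_def presented_carrier_eq)
  qed
  show "\<phi> \<in> hom (presented_group X R) G"
  proof (rule homI)
    fix C assume "C \<in> carrier (presented_group X R)"
    then show "\<phi> C \<in> carrier G"
      by (elim presented_carrierE) (simp only: \<phi>_class eval_word_closed[OF f'])
  next
    fix C D assume "C \<in> carrier (presented_group X R)" "D \<in> carrier (presented_group X R)"
    then show "\<phi> (C \<otimes>\<^bsub>presented_group X R\<^esub> D) = \<phi> C \<otimes> \<phi> D"
      by (elim presented_carrierE)
         (simp only: presented_mult_class \<phi>_class append_in_lists_conv eval_word_append[OF f']
            HOL.simp_thms)
  qed
  show "\<phi> \<in> extensional (carrier (presented_group X R))"
    by (simp add: \<phi>_def)
  show "\<phi> (presented_gen X R x) = f x" if "x \<in> X" for x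
    using that f' by (auto simp: presented_gen_def \<phi>_class eval_word_def eval_letter_def f'_def)
qed

text \<open>A word is the product of its letters, so multiplicativity reduces everything to the
  empty word and single letters. It underlies both uniqueness of homomorphisms and the description
  of their images.\<close>

lemma presented_hom_class:
  assumes \<phi>: "\<phi> \<in> hom (presented_group X R) G" and w: "w \<in> lists (X \<times> UNIV)"
  shows "\<phi> (word_rel X R `` {w}) = eval_word G (\<lambda>x. \<phi> (presented_gen X R x)) w"
proof -
  have one: "\<phi> (word_rel X R `` {[]}) = \<one>"
  proof -
    \<comment> \<open>The image of the empty class is idempotent, and the only idempotent of a group
      is its unit.\<close>
    have "\<phi> (word_rel X R `` {[]}) \<otimes> \<phi> (word_rel X R `` {[]}) = \<phi> (word_rel X R `` {[]})"
      using hom_mult[OF \<phi>, of "word_rel X R `` {[]}" "word_rel X R `` {[]}"]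
      by (simp add: presented_mult_class presented_carrier_eq)
    moreover have "\<phi> (word_rel X R `` {[]}) \<in> carrier G"
      using hom_in_carrier[OF \<phi>] by (simp add: presented_carrier_eq)
    ultimately show ?thesis by simp
  qed
  show ?thesis
    using w
  proof (induction w)
    case Nil
    then show ?case by (simp add: one eval_word_def)
  next
    case (Cons l w)
    obtain x b where l: "l = (x, b)" and x: "x \<in> X" using Cons.hyps by (cases l) auto
    have in_carrier: "word_rel X R `` {[(x, b)]} \<in> carrier (presented_group X R)" for b
      using x by (simp add: presented_carrier_eq)
    have "\<phi> (presented_gen X R x) \<otimes> \<phi> (word_rel X R `` {[(x, False)]}) = \<one>"
      using hom_mult[OF \<phi>, of "presented_gen X R x" "word_rel X R `` {[(x, False)]}"]
        x in_carrier by (simp add: presented_gen_in_carrier presented_inverse_letter one)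
    then have "\<phi> (word_rel X R `` {[(x, False)]}) = inv \<phi> (presented_gen X R x)"
      using hom_in_carrier[OF \<phi>] x in_carrier
      by (metis inv_equality inv_inv inv_closed presented_gen_in_carrier)
    then have letter: "\<phi> (word_rel X R `` {[l]}) = eval_letter G (\<lambda>x. \<phi> (presented_gen X R x)) l"
      by (cases b) (simp_all add: l eval_letter_def presented_gen_def)
    have "\<phi> (word_rel X R `` {l # w}) = \<phi> (word_rel X R `` {[l]}) \<otimes> \<phi> (word_rel X R `` {w})"
      using hom_mult[OF \<phi>, of "word_rel X R `` {[l]}" "word_rel X R `` {w}"] Cons.hyps x
      by (auto simp add: presented_mult_class presented_carrier_eq l)
    then show ?case
      using Cons letter by (simp add: eval_word_def)
  qed
qed

lemma presented_hom_unique: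
  assumes \<phi>: "\<phi> \<in> hom (presented_group X R) G" "\<phi> \<in> extensional (carrier (presented_group X R))"
    and \<psi>: "\<psi> \<in> hom (presented_group X R) G" "\<psi> \<in> extensional (carrier (presented_group X R))"
    and eq: "\<And>x. x \<in> X \<Longrightarrow> \<phi> (presented_gen X R x) = \<psi> (presented_gen X R x)"
  shows "\<phi> = \<psi>"
proof (rule extensionalityI[OF \<phi>(2) \<psi>(2)])
  fix C assume "C \<in> carrier (presented_group X R)"
  then obtain w where w: "w \<in> lists (X \<times> UNIV)" and C: "C = word_rel X R `` {w}"
    by (auto simp: presented_carrier_eq)
  have "eval_word G (\<lambda>x. \<phi> (presented_gen X R x)) w = eval_word G (\<lambda>x. \<psi> (presented_gen X R x)) w"
    using w by (induction w) (auto simp: eval_word_def eval_letter_def eq)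
  then show "\<phi> C = \<psi> C"
    by (simp add: C presented_hom_class[OF \<phi>(1) w] presented_hom_class[OF \<psi>(1) w])
qed

text \<open>One inclusion reads the value of a word as a product of generator values and their
  inverses; the other follows the inductive construction of \<open>generate\<close>, where a
  one-letter word supplies each inverse.\<close>

lemma presented_hom_image:
  assumes \<phi>: "\<phi> \<in> hom (presented_group X R) G"
  shows "\<phi> ` carrier (presented_group X R) = generate G (\<phi> ` presented_gen X R ` X)"
proof
  have "eval_word G (\<lambda>x. \<phi> (presented_gen X R x)) w \<in> generate G (\<phi> ` presented_gen X R ` X)"
    if "w \<in> lists (X \<times> UNIV)" for w
    using that
  proof (induction w)
    case Nil
    then show ?case by (simp add: eval_word_def generate.one)
  next
    case (Cons l w)
    then have "eval_letter G (\<lambda>x. \<phi> (presented_gen X R x)) l \<in> generate G (\<phi> ` presented_gen X R ` X)"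
      by (cases l) (simp add: eval_letter_def generate.incl generate.inv)
    then show ?case
      using Cons.IH by (simp add: eval_word_def generate.eng)
  qed
  then show "\<phi> ` carrier (presented_group X R) \<subseteq> generate G (\<phi> ` presented_gen X R ` X)"
    by (intro image_subsetI) (elim presented_carrierE, simp only: presented_hom_class[OF \<phi>])
next
  have gen: "\<phi> (presented_gen X R x) \<in> carrier G" if "x \<in> X" for x
    using hom_in_carrier[OF \<phi>] presented_gen_in_carrier[OF that] by blast
  have image: "eval_word G (\<lambda>x. \<phi> (presented_gen X R x)) w \<in> \<phi> ` carrier (presented_group X R)"
    if "w \<in> lists (X \<times> UNIV)" for w
  proof -
    have "word_rel X R `` {w} \<in> carrier (presented_group X R)"
      unfolding presented_carrier_eq using that by (rule imageI)
    then show ?thesis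
      unfolding presented_hom_class[OF \<phi> that, symmetric] by (rule imageI)
  qed
  show "generate G (\<phi> ` presented_gen X R ` X) \<subseteq> \<phi> ` carrier (presented_group X R)"
  proof
    fix k assume "k \<in> generate G (\<phi> ` presented_gen X R ` X)"
    then show "k \<in> \<phi> ` carrier (presented_group X R)"
    proof (induction rule: generate.induct)
      case one
      then show ?case using image[of "[]"] by (simp add: eval_word_def)
    next
      case (incl k)
      then obtain x where "x \<in> X" "k = \<phi> (presented_gen X R x)" by auto
      then show ?case using presented_gen_in_carrier by (intro image_eqI)
    next
      case (inv k)
      then obtain x where "x \<in> X" "k = \<phi> (presented_gen X R x)" by auto
      then show ?case
        using image[of "[(x, False)]"] gen by (simp add: eval_word_def eval_letter_def)
    next
      case (eng k l)
      then obtain C D where CD: "C \<in> carrier (presented_group X R)" "D \<in> carrier (presented_group X R)"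
        and "k = \<phi> C" "l = \<phi> D"
        by blast
      then have "k \<otimes> l = \<phi> (C \<otimes>\<^bsub>presented_group X R\<^esub> D)"
        by (simp only: hom_mult[OF \<phi>])
      then show ?case using presented_mult_closed[OF CD] by (rule image_eqI)
    qed
  qed
qed

end

subsection \<open>The lower central series\<close>

context group
begin

lemma commutator_closed:
  "g \<in> carrier G \<Longrightarrow> h \<in> carrier G \<Longrightarrow> commutator G g h \<in> carrier G"
  by (simp add: commutator_def)

text \<open>Clears the inverses from the commutator, so that commutators in the extension can be
  found without computing inverses there.\<close>

lemma commutator_eq_iff:
  assumes "g \<in> carrier G" "h \<in> carrier G" "k \<in> carrier G"
  shows "commutator G g h = k \<longleftrightarrow> g \<otimes> h = k \<otimes> (h \<otimes> g)"
proof -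
  have "commutator G g h = g \<otimes> h \<otimes> inv (h \<otimes> g)"
    using assms by (simp add: commutator_def inv_mult_group m_assoc)
  then show ?thesis
    using assms by (metis inv_solve_right' m_closed)
qed

lemma commutator_subgroup_eq_one:
  assumes "\<And>h k. h \<in> H \<Longrightarrow> k \<in> K \<Longrightarrow> commutator G h k = \<one>"
  shows "commutator_subgroup G H K = {\<one>}"
proof -
  have "{commutator G h k | h k. h \<in> H \<and> k \<in> K} \<subseteq> {\<one>}" using assms by auto
  then have "commutator_subgroup G H K \<subseteq> generate G {\<one>}"
    unfolding commutator_subgroup_def by (rule mono_generate)
  moreover have "\<one> \<in> commutator_subgroup G H K"
    unfolding commutator_subgroup_def by (rule generate.one)
  ultimately show ?thesis by (auto simp: generate_one)
qed

lemma lower_central_series_in_carrier: "lower_central_series G n \<subseteq> carrier G"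
proof (induction n)
  case (Suc n)
  then show ?case
    unfolding lower_central_series.simps commutator_subgroup_def
    by (intro generate_incl) (auto intro: commutator_closed)
qed simp

lemma one_in_lower_central_series: "\<one> \<in> lower_central_series G n"
  by (cases n) (auto simp: commutator_subgroup_def intro: generate.one)

text \<open>The bracket with the whole group is monotone in its second argument, which carries the
  inclusion from one index to the next.\<close>

lemma lower_central_series_Suc_subset:
  "lower_central_series G (Suc n) \<subseteq> lower_central_series G n"
proof (induction n)
  case 0
  then show ?case using lower_central_series_in_carrier[of "Suc 0"] by simp
next
  case (Suc n)
  then have "{commutator G h k | h k. h \<in> carrier G \<and> k \<in> lower_central_series G (Suc n)} \<subseteq>
      {commutator G h k | h k. h \<in> carrier G \<and> k \<in> lower_central_series G n}"
    by blast
  then show ?case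
    unfolding lower_central_series.simps(2)[of G "Suc n"] lower_central_series.simps(2)[of G n]
      commutator_subgroup_def
    by (auto dest: mono_generate)
qed

lemma lower_central_series_antimono:
  "m \<le> n \<Longrightarrow> lower_central_series G n \<subseteq> lower_central_series G m"
  by (rule lift_Suc_antimono_le) (rule lower_central_series_Suc_subset)

text \<open>The series descends and is trivial from index \<open>Suc n\<close> on, so every
  non-trivial term has index at most \<open>n\<close> and contains the term at
  \<open>n\<close>.\<close>

lemma is_last_lcs_term_iff:
  assumes "lower_central_series G n \<noteq> {\<one>}" "lower_central_series G (Suc n) = {\<one>}"
  shows "is_last_lcs_term G H \<longleftrightarrow> H = lower_central_series G n"
proof -
  have subset: "lower_central_series G n \<subseteq> lower_central_series G m"
    if "lower_central_series G m \<noteq> {\<one>}" for m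
  proof (rule lower_central_series_antimono, rule ccontr)
    assume "\<not> m \<le> n"
    then have "lower_central_series G m \<subseteq> {\<one>}"
      using lower_central_series_antimono[of "Suc n" m] assms(2) by simp
    then show False using that one_in_lower_central_series[of m] by blast
  qed
  show ?thesis
  proof
    assume H: "is_last_lcs_term G H"
    then obtain m where "H = lower_central_series G m" "H \<noteq> {\<one>}"
      by (auto simp: is_last_lcs_term_def)
    moreover have "H \<subseteq> lower_central_series G n"
      using H assms(1) by (auto simp: is_last_lcs_term_def)
    ultimately show "H = lower_central_series G n" using subset by blast
  qed (use assms(1) subset in \<open>auto simp: is_last_lcs_term_def\<close>)
qed

end

text \<open>Homomorphisms preserve commutators and generation; surjectivity supplies preimages for
  the arbitrary group element in each commutator.\<close>

lemma (in group_hom) lower_central_series_image: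
  assumes "h ` carrier G = carrier H"
  shows "h ` lower_central_series G n = lower_central_series H n"
proof (induction n)
  case 0
  then show ?case using assms by simp
next
  case (Suc n)
  let ?C = "{commutator G g k | g k. g \<in> carrier G \<and> k \<in> lower_central_series G n}"
  have C: "?C \<subseteq> carrier G"
    using G.lower_central_series_in_carrier[of n] by (auto intro: G.commutator_closed)
  have hc: "h (commutator G g k) = commutator H (h g) (h k)"
    if "g \<in> carrier G" "k \<in> lower_central_series G n" for g k
    using that G.lower_central_series_in_carrier[of n]
    by (auto simp: commutator_def subset_iff)
  have "h ` ?C = {commutator H g k | g k. g \<in> h ` carrier G \<and> k \<in> h ` lower_central_series G n}"
  proof (intro equalityI subsetI)
    fix y assume "y \<in> {commutator H g k | g k. g \<in> h ` carrier G \<and> k \<in> h ` lower_central_series G n}"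
    then obtain g k where "g \<in> carrier G" "k \<in> lower_central_series G n"
      "y = commutator H (h g) (h k)"
      by blast
    then show "y \<in> h ` ?C" using hc[of g k] by (intro image_eqI[of _ _ "commutator G g k"]) auto
  qed (use hc in blast)
  then show ?case
    using generate_img[OF C] by (simp add: commutator_subgroup_def Suc assms)
qed

text \<open>The least index with a trivial term is positive, because term 0 is the non-trivial
  carrier; \<open>n\<close> is its predecessor.\<close>

lemma nilpotent_last_lcs_term:
  assumes "nilpotent_group G" "carrier G \<noteq> {\<one>\<^bsub>G\<^esub>}"
  obtains n where "last_lcs_term G = lower_central_series G n"
    and "lower_central_series G n \<noteq> {\<one>\<^bsub>G\<^esub>}" and "lower_central_series G (Suc n) = {\<one>\<^bsub>G\<^esub>}"
proof -
  interpret group G using assms(1) by (simp add: nilpotent_group_def)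
  obtain m where "lower_central_series G m = {\<one>\<^bsub>G\<^esub>}"
    using assms(1) by (auto simp: nilpotent_group_def)
  then obtain n where "lower_central_series G n \<noteq> {\<one>\<^bsub>G\<^esub>}" "lower_central_series G (Suc n) = {\<one>\<^bsub>G\<^esub>}"
    using assms(2) ex_least_nat_less[of "\<lambda>n. lower_central_series G n = {\<one>\<^bsub>G\<^esub>}" m]
    by (metis lower_central_series.simps(1) le_refl)
  then show thesis
    using that[of n] is_last_lcs_term_iff[of n] by (simp add: last_lcs_term_def)
qed

subsection \<open>Central extensions by cocycles\<close>

locale cocycle_ext = G: group G + A: comm_group A
  for G :: "('a, 'm) monoid_scheme" (structure) and A :: "('b, 'n) monoid_scheme" +
  fixes \<delta> :: "'a \<Rightarrow> 'a \<Rightarrow> 'b"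
  assumes cocycle: "\<delta> \<in> cocycles2 G A"
begin

abbreviation "E \<equiv> cocycle_extension G A \<delta>"

text \<open>The antisymmetrization of \<open>\<delta>\<close>. On commuting pairs it is the
  commutator pairing of the extension and coincides with \<open>cocycle_hat\<close>.\<close>

definition cocycle_alt :: "'a \<Rightarrow> 'a \<Rightarrow> 'b" where
  "cocycle_alt g h = \<delta> g h \<otimes>\<^bsub>A\<^esub> inv\<^bsub>A\<^esub> \<delta> h g"

lemma cocycle_closed: "g \<in> carrier G \<Longrightarrow> h \<in> carrier G \<Longrightarrow> \<delta> g h \<in> carrier A"
  and cocycle_eq: "g \<in> carrier G \<Longrightarrow> h \<in> carrier G \<Longrightarrow> k \<in> carrier G \<Longrightarrow>
    \<delta> g h \<otimes>\<^bsub>A\<^esub> \<delta> (g \<otimes> h) k = \<delta> h k \<otimes>\<^bsub>A\<^esub> \<delta> g (h \<otimes> k)"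
  and cocycle_one: "g \<in> carrier G \<Longrightarrow> \<delta> g \<one> = \<one>\<^bsub>A\<^esub>" "g \<in> carrier G \<Longrightarrow> \<delta> \<one> g = \<one>\<^bsub>A\<^esub>"
  using cocycle by (simp_all add: cocycles2_def)

lemma cocycle_alt_closed: "g \<in> carrier G \<Longrightarrow> h \<in> carrier G \<Longrightarrow> cocycle_alt g h \<in> carrier A"
  by (simp add: cocycle_alt_def cocycle_closed)

lemma carrier_E: "carrier E = carrier G \<times> carrier A"
  and mult_E: "(g, a) \<otimes>\<^bsub>E\<^esub> (h, b) = (g \<otimes> h, a \<otimes>\<^bsub>A\<^esub> b \<otimes>\<^bsub>A\<^esub> \<delta> g h)"
  and one_E: "\<one>\<^bsub>E\<^esub> = (\<one>, \<one>\<^bsub>A\<^esub>)"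
  by (simp_all add: cocycle_extension_def)

text \<open>Associativity is exactly the cocycle identity, and normalization of
  \<open>\<delta>\<close> gives the unit.\<close>

lemma group_E: "group E"
proof (rule groupI)
  fix x y z assume "x \<in> carrier E" "y \<in> carrier E" "z \<in> carrier E"
  then obtain g a h b k c where x: "x = (g, a)" "g \<in> carrier G" "a \<in> carrier A"
    and y: "y = (h, b)" "h \<in> carrier G" "b \<in> carrier A"
    and z: "z = (k, c)" "k \<in> carrier G" "c \<in> carrier A"
    by (auto simp: carrier_E)
  have "a \<otimes>\<^bsub>A\<^esub> b \<otimes>\<^bsub>A\<^esub> \<delta> g h \<otimes>\<^bsub>A\<^esub> c \<otimes>\<^bsub>A\<^esub> \<delta> (g \<otimes> h) k =
      a \<otimes>\<^bsub>A\<^esub> b \<otimes>\<^bsub>A\<^esub> c \<otimes>\<^bsub>A\<^esub> (\<delta> g h \<otimes>\<^bsub>A\<^esub> \<delta> (g \<otimes> h) k)"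
    using x y z by (simp add: cocycle_closed A.m_ac)
  also have "\<dots> = a \<otimes>\<^bsub>A\<^esub> (b \<otimes>\<^bsub>A\<^esub> c \<otimes>\<^bsub>A\<^esub> \<delta> h k) \<otimes>\<^bsub>A\<^esub> \<delta> g (h \<otimes> k)"
    using x y z by (simp add: cocycle_closed A.m_ac cocycle_eq)
  finally show "x \<otimes>\<^bsub>E\<^esub> y \<otimes>\<^bsub>E\<^esub> z = x \<otimes>\<^bsub>E\<^esub> (y \<otimes>\<^bsub>E\<^esub> z)"
    using x y z by (simp add: mult_E G.m_assoc)
next
  fix x assume "x \<in> carrier E"
  then obtain g a where x: "x = (g, a)" "g \<in> carrier G" "a \<in> carrier A"
    by (auto simp: carrier_E)
  \<comment> \<open>The second component must cancel both \<open>a\<close> and the cocycle value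
    created by multiplying \<open>inv g\<close> with \<open>g\<close>.\<close>
  let ?y = "(inv g, inv\<^bsub>A\<^esub> (a \<otimes>\<^bsub>A\<^esub> \<delta> (inv g) g))"
  have "?y \<otimes>\<^bsub>E\<^esub> x = \<one>\<^bsub>E\<^esub>"
    using x A.l_inv[of "a \<otimes>\<^bsub>A\<^esub> \<delta> (inv g) g"]
    by (simp add: mult_E one_E cocycle_closed A.m_assoc)
  moreover have "?y \<in> carrier E" using x by (simp add: carrier_E cocycle_closed)
  ultimately show "\<exists>y\<in>carrier E. y \<otimes>\<^bsub>E\<^esub> x = \<one>\<^bsub>E\<^esub>" by blast
qed (auto simp: carrier_E mult_E one_E cocycle_closed cocycle_one)

sublocale E: group E by (rule group_E)

section \<open>Projection, coefficient embedding and the commutator pairing\<close>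

lemma projection_hom: "group_hom E G fst"
  by unfold_locales (auto intro!: homI simp: carrier_E mult_E)

lemma coefficient_hom: "group_hom A E (\<lambda>a. (\<one>, a))"
  by unfold_locales (auto intro!: homI simp: carrier_E mult_E cocycle_one)

text \<open>The two orders of multiplication differ only in the cocycle value, since
  \<open>g\<close> and \<open>h\<close> commute and so do \<open>a\<close> and \<open>b\<close>.
  Hence the lifts do not matter.\<close>

lemma commutator_E:
  assumes "g \<in> carrier G" "h \<in> carrier G" "g \<otimes> h = h \<otimes> g" "a \<in> carrier A" "b \<in> carrier A"
  shows "commutator E (g, a) (h, b) = (\<one>, cocycle_alt g h)"
proof -
  have "cocycle_alt g h \<otimes>\<^bsub>A\<^esub> (b \<otimes>\<^bsub>A\<^esub> a \<otimes>\<^bsub>A\<^esub> \<delta> h g) =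
      a \<otimes>\<^bsub>A\<^esub> b \<otimes>\<^bsub>A\<^esub> \<delta> g h \<otimes>\<^bsub>A\<^esub> (inv\<^bsub>A\<^esub> \<delta> h g \<otimes>\<^bsub>A\<^esub> \<delta> h g)"
    using assms unfolding cocycle_alt_def by (simp only: A.m_ac cocycle_closed A.inv_closed A.m_closed)
  also have "\<dots> = a \<otimes>\<^bsub>A\<^esub> b \<otimes>\<^bsub>A\<^esub> \<delta> g h"
    using assms by (simp add: cocycle_closed)
  finally show ?thesis
    using assms
    by (subst E.commutator_eq_iff)
       (auto simp: carrier_E mult_E cocycle_alt_closed cocycle_one cocycle_closed)
qed

lemma coefficient_central:
  assumes "x \<in> carrier E" "a \<in> carrier A"
  shows "x \<otimes>\<^bsub>E\<^esub> (\<one>, a) = (\<one>, a) \<otimes>\<^bsub>E\<^esub> x"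
  using assms by (auto simp: carrier_E mult_E cocycle_one A.m_comm)

text \<open>Obtained from commutators in the extension: \<open>[xy,z] = [y,z][x,z]\<close> holds
  when \<open>[y,z]\<close> is central, and here these commutators lie in the central copy of the
  coefficients.\<close>

lemma cocycle_alt_mult_left:
  assumes g: "g \<in> carrier G" and g': "g' \<in> carrier G" and h: "h \<in> carrier G"
    and comm: "g \<otimes> h = h \<otimes> g" "g' \<otimes> h = h \<otimes> g'"
  shows "cocycle_alt (g \<otimes> g') h = cocycle_alt g h \<otimes>\<^bsub>A\<^esub> cocycle_alt g' h"
proof -
  let ?x = "(g, \<one>\<^bsub>A\<^esub>)" and ?y = "(g', \<one>\<^bsub>A\<^esub>)" and ?z = "(h, \<one>\<^bsub>A\<^esub>)"
  let ?c = "(\<one>, cocycle_alt g h)" and ?d = "(\<one>, cocycle_alt g' h)"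
  have cl: "?x \<in> carrier E" "?y \<in> carrier E" "?z \<in> carrier E" "?c \<in> carrier E" "?d \<in> carrier E"
    using assms by (simp_all add: carrier_E cocycle_alt_closed)
  have xz: "?x \<otimes>\<^bsub>E\<^esub> ?z = ?c \<otimes>\<^bsub>E\<^esub> (?z \<otimes>\<^bsub>E\<^esub> ?x)"
    and yz: "?y \<otimes>\<^bsub>E\<^esub> ?z = ?d \<otimes>\<^bsub>E\<^esub> (?z \<otimes>\<^bsub>E\<^esub> ?y)"
    using commutator_E assms cl by (simp_all add: E.commutator_eq_iff[symmetric])
  have "(?x \<otimes>\<^bsub>E\<^esub> ?y) \<otimes>\<^bsub>E\<^esub> ?z = (?x \<otimes>\<^bsub>E\<^esub> ?d) \<otimes>\<^bsub>E\<^esub> (?z \<otimes>\<^bsub>E\<^esub> ?y)"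
    using cl yz by (simp only: E.m_assoc E.m_closed)
  \<comment> \<open>Centrality of \<open>?d\<close> brings \<open>?x\<close> next to
    \<open>?z\<close>, so that \<open>xz\<close> applies.\<close>
  also have "?x \<otimes>\<^bsub>E\<^esub> ?d = ?d \<otimes>\<^bsub>E\<^esub> ?x"
    using cl assms by (simp only: coefficient_central cocycle_alt_closed)
  also have "?d \<otimes>\<^bsub>E\<^esub> ?x \<otimes>\<^bsub>E\<^esub> (?z \<otimes>\<^bsub>E\<^esub> ?y) = ?d \<otimes>\<^bsub>E\<^esub> (?x \<otimes>\<^bsub>E\<^esub> ?z) \<otimes>\<^bsub>E\<^esub> ?y"
    using cl by (simp only: E.m_assoc E.m_closed)
  also have "\<dots> = (?d \<otimes>\<^bsub>E\<^esub> ?c) \<otimes>\<^bsub>E\<^esub> (?z \<otimes>\<^bsub>E\<^esub> (?x \<otimes>\<^bsub>E\<^esub> ?y))"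
    unfolding xz using cl by (simp only: E.m_assoc E.m_closed)
  finally have "commutator E (?x \<otimes>\<^bsub>E\<^esub> ?y) ?z = ?d \<otimes>\<^bsub>E\<^esub> ?c"
    using cl by (simp only: E.commutator_eq_iff E.m_closed)
  moreover have "(g \<otimes> g') \<otimes> h = h \<otimes> (g \<otimes> g')"
    using assms by (metis G.m_assoc)
  \<comment> \<open>The product of \<open>?x\<close> and \<open>?y\<close> is a lift of
    \<open>g \<otimes> g'\<close> with second component \<open>\<delta> g g'\<close>, which
    \<open>commutator_E\<close> ignores.\<close>
  ultimately have "cocycle_alt (g \<otimes> g') h = cocycle_alt g' h \<otimes>\<^bsub>A\<^esub> cocycle_alt g h"
    using assms by (simp add: mult_E commutator_E cocycle_closed cocycle_one cocycle_alt_closed)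
  then show ?thesis using assms by (simp add: A.m_comm cocycle_alt_closed)
qed

lemma cocycle_alt_inv:
  "g \<in> carrier G \<Longrightarrow> h \<in> carrier G \<Longrightarrow> inv\<^bsub>A\<^esub> cocycle_alt g h = cocycle_alt h g"
  by (simp add: cocycle_alt_def cocycle_closed A.inv_mult_group)

lemma cocycle_alt_mult_right:
  assumes "g \<in> carrier G" "h \<in> carrier G" "h' \<in> carrier G"
    and "g \<otimes> h = h \<otimes> g" "g \<otimes> h' = h' \<otimes> g"
  shows "cocycle_alt g (h \<otimes> h') = cocycle_alt g h \<otimes>\<^bsub>A\<^esub> cocycle_alt g h'"
proof -
  have "cocycle_alt g (h \<otimes> h') = inv\<^bsub>A\<^esub> cocycle_alt (h \<otimes> h') g"
    using assms by (simp add: cocycle_alt_inv)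
  also have "\<dots> = inv\<^bsub>A\<^esub> cocycle_alt h g \<otimes>\<^bsub>A\<^esub> inv\<^bsub>A\<^esub> cocycle_alt h' g"
    using assms by (simp add: cocycle_alt_mult_left A.inv_mult cocycle_alt_closed)
  finally show ?thesis using assms by (simp add: cocycle_alt_inv)
qed

text \<open>When \<open>g\<close> and \<open>h\<close> commute, the last two factors of
  \<open>cocycle_hat\<close> are inverse to each other.\<close>

lemma cocycle_hat_central:
  assumes "g \<in> carrier G" "h \<in> carrier G" "g \<otimes> h = h \<otimes> g"
  shows "cocycle_hat G A \<delta> g h = cocycle_alt g h"
  using assms
  by (simp add: cocycle_hat_def cocycle_alt_def cocycle_closed A.m_assoc)

end

subsection \<open>The map \<open>\<kappa>\<close>\<close>

lemma (in group) conjugate_central: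
  "g \<in> carrier G \<Longrightarrow> h \<in> carrier G \<Longrightarrow> g \<otimes> h = h \<otimes> g \<Longrightarrow> conjugate G g h = h"
  by (simp add: conjugate_def m_assoc)

lemma (in group) conjugate_closed:
  "g \<in> carrier G \<Longrightarrow> h \<in> carrier G \<Longrightarrow> conjugate G g h \<in> carrier G"
  by (simp add: conjugate_def)

lemma (in group) exterior_rels_in_lists:
  assumes "subgroup H G" "\<And>g h. g \<in> carrier G \<Longrightarrow> h \<in> H \<Longrightarrow> g \<otimes> h = h \<otimes> g"
    and "(r, s) \<in> exterior_rels G H"
  shows "r \<in> lists ((carrier G \<times> H) \<times> UNIV) \<and> s \<in> lists ((carrier G \<times> H) \<times> UNIV)"
proof -
  have "conjugate G g h \<in> H" if "g \<in> carrier G" "h \<in> H" for g h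
    using that assms(2)[OF that] subgroup.mem_carrier[OF assms(1)] by (simp add: conjugate_central)
  then show ?thesis
    using assms(3) conjugate_closed subgroup.m_closed[OF assms(1)] subgroup.mem_carrier[OF assms(1)]
    by (auto simp: exterior_rels_def)
qed

text \<open>For central \<open>H\<close> the commutator map has trivial target, so the description
  by \<open>THE\<close> is met only by the constant map, whose kernel is everything.\<close>

lemma schur_multiplier_pair_central:
  assumes "group G" and H: "subgroup H G"
    and comm: "\<And>g h. g \<in> carrier G \<Longrightarrow> h \<in> H \<Longrightarrow> g \<otimes>\<^bsub>G\<^esub> h = h \<otimes>\<^bsub>G\<^esub> g"
  shows "schur_multiplier_pair G H = exterior_product G H"
proof -
  interpret group G by fact
  have commutator: "commutator G g h = \<one>\<^bsub>G\<^esub>" if "g \<in> carrier G" "h \<in> H" for g h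
    using that comm subgroup.mem_carrier[OF H] by (simp add: commutator_eq_iff)
  let ?T = "G\<lparr>carrier := commutator_subgroup G (carrier G) H\<rparr>"
  let ?P = "\<lambda>\<phi>. \<phi> \<in> hom (exterior_product G H) ?T \<and>
     \<phi> \<in> extensional (carrier (exterior_product G H)) \<and>
     (\<forall>g \<in> carrier G. \<forall>h \<in> H. \<phi> (wedge G H g h) = commutator G g h)"
  let ?\<phi> = "\<lambda>C \<in> carrier (exterior_product G H). \<one>\<^bsub>G\<^esub>"
  have T: "carrier ?T = {\<one>\<^bsub>G\<^esub>}"
    using commutator by (simp add: commutator_subgroup_eq_one)
  have closed: "C \<otimes>\<^bsub>exterior_product G H\<^esub> D \<in> carrier (exterior_product G H)"
    if "C \<in> carrier (exterior_product G H)" "D \<in> carrier (exterior_product G H)" for C D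
    using that unfolding exterior_product_def by (rule presented_mult_closed)
  have "?P ?\<phi>"
    using T closed commutator
    by (auto simp: hom_def wedge_def exterior_product_def presented_gen_in_carrier)
  moreover have "\<psi> = ?\<phi>" if "?P \<psi>" for \<psi>
    using that T by (intro extensionalityI[of _ "carrier (exterior_product G H)"])
      (auto simp: hom_def)
  ultimately have "wedge_commutator_map G H = ?\<phi>"
    unfolding wedge_commutator_map_def by (rule the_equality)
  then have "kernel (exterior_product G H) ?T (wedge_commutator_map G H) =
      carrier (exterior_product G H)"
    by (auto simp: kernel_def)
  then show ?thesis by (simp add: schur_multiplier_pair_def)
qed

text \<open>On pairs with second entry in the central subgroup the pairing is bimultiplicative,
  trivial on the diagonal and unaffected by conjugation, which is what the three families of
  relations ask for.\<close>

lemma (in cocycle_ext) eval_exterior_rels: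
  assumes H: "subgroup H G"
    and comm: "\<And>g h. g \<in> carrier G \<Longrightarrow> h \<in> H \<Longrightarrow> g \<otimes> h = h \<otimes> g"
    and rel: "(r, s) \<in> exterior_rels G H"
  shows "eval_word A (\<lambda>(g, h). cocycle_alt g h) r = eval_word A (\<lambda>(g, h). cocycle_alt g h) s"
proof -
  have HG: "h \<in> carrier G" if "h \<in> H" for h
    using that by (rule subgroup.mem_carrier[OF H])
  have conj_alt: "cocycle_alt (conjugate G g g') h = cocycle_alt g' h"
    if "g \<in> carrier G" "g' \<in> carrier G" "h \<in> H" for g g' h
  proof -
    \<comment> \<open>The conjugate of \<open>g'\<close> can differ from \<open>g'\<close>;
      multiplying it by \<open>g\<close> gives \<open>g \<otimes> g'\<close>, and the factor for
      \<open>g\<close> then cancels in the commutative group \<open>A\<close>.\<close>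
    have "cocycle_alt (conjugate G g g') h \<otimes>\<^bsub>A\<^esub> cocycle_alt g h =
        cocycle_alt (conjugate G g g' \<otimes> g) h"
      using that G.conjugate_closed[OF that(1,2)]
      by (intro cocycle_alt_mult_left[symmetric] comm) (simp_all add: HG)
    also have "conjugate G g g' \<otimes> g = g \<otimes> g'"
      using that by (simp add: conjugate_def G.m_assoc)
    also have "cocycle_alt (g \<otimes> g') h = cocycle_alt g' h \<otimes>\<^bsub>A\<^esub> cocycle_alt g h"
      using that comm[OF that(1,3)] comm[OF that(2,3)]
      by (simp add: cocycle_alt_mult_left HG A.m_comm cocycle_alt_closed)
    finally show ?thesis
      using that by (simp add: cocycle_alt_closed HG G.conjugate_closed)
  qed
  from rel consider
    (left) g g' h where "g \<in> carrier G" "g' \<in> carrier G" "h \<in> H" "r = [((g \<otimes> g', h), True)]"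
      "s = [((conjugate G g g', conjugate G g h), True), ((g, h), True)]"
  | (right) g h h' where "g \<in> carrier G" "h \<in> H" "h' \<in> H" "r = [((g, h \<otimes> h'), True)]"
      "s = [((g, h), True), ((conjugate G h g, conjugate G h h'), True)]"
  | (diag) h where "h \<in> H" "r = [((h, h), True)]" "s = []"
    unfolding exterior_rels_def by blast
  then show ?thesis
  proof cases
    case left
    then show ?thesis
      using comm[OF left(1,3)] comm[OF left(2,3)]
      by (simp add: eval_word_def eval_letter_def G.conjugate_central HG conj_alt
          cocycle_alt_mult_left cocycle_alt_closed A.m_comm)
  next
    case right
    then show ?thesis
      using comm[OF right(1,2)] comm[OF right(1,3)] comm[OF HG[OF right(2)] right(3)]
        comm[OF HG[OF right(2)] right(2)]
      by (simp add: eval_word_def eval_letter_def G.conjugate_central HG conj_alt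
          cocycle_alt_mult_right cocycle_alt_closed A.m_comm)
  next
    case diag
    then show ?thesis
      by (simp add: eval_word_def eval_letter_def cocycle_alt_def cocycle_closed HG)
  qed
qed

text \<open>Von Dyck's theorem yields a homomorphism with the prescribed values on wedges.
  Uniqueness identifies it with \<open>kappa\<close>, so its image is generated by those
  values.\<close>

lemma (in cocycle_ext) kappa_image:
  assumes H: "subgroup (last_lcs_term G) G"
    and comm: "\<And>g h. g \<in> carrier G \<Longrightarrow> h \<in> last_lcs_term G \<Longrightarrow> g \<otimes> h = h \<otimes> g"
  shows "kappa G A \<delta> ` carrier (schur_multiplier_pair G (last_lcs_term G)) =
    generate A {cocycle_alt g h | g h. g \<in> carrier G \<and> h \<in> last_lcs_term G}"
proof -
  let ?H = "last_lcs_term G"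
  let ?X = "carrier G \<times> ?H" and ?R = "exterior_rels G ?H"
  have HG: "h \<in> carrier G" if "h \<in> ?H" for h
    using that by (rule subgroup.mem_carrier[OF H])
  have M: "schur_multiplier_pair G ?H = presented_group ?X ?R"
    using schur_multiplier_pair_central[OF G.is_group H comm] by (simp add: exterior_product_def)
  have hat: "cocycle_hat G A \<delta> g h = cocycle_alt g h" if "g \<in> carrier G" "h \<in> ?H" for g h
    using that comm[OF that] by (simp add: cocycle_hat_central HG)
  have "(\<lambda>(g, h). cocycle_alt g h) \<in> ?X \<rightarrow> carrier A"
    by (auto simp: cocycle_alt_closed HG)
  moreover have "r \<in> lists (?X \<times> UNIV) \<and> s \<in> lists (?X \<times> UNIV) \<and>
      eval_word A (\<lambda>(g, h). cocycle_alt g h) r = eval_word A (\<lambda>(g, h). cocycle_alt g h) s"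
    if "(r, s) \<in> ?R" for r s
    using eval_exterior_rels[OF H comm that] G.exterior_rels_in_lists[OF H comm that] by simp
  ultimately obtain \<phi> where \<phi>: "\<phi> \<in> hom (presented_group ?X ?R) A"
    "\<phi> \<in> extensional (carrier (presented_group ?X ?R))"
    "\<And>x. x \<in> ?X \<Longrightarrow> \<phi> (presented_gen ?X ?R x) = (\<lambda>(g, h). cocycle_alt g h) x"
    using A.presented_group_hom_exists[of "\<lambda>(g, h). cocycle_alt g h" ?X ?R] by metis
  have "kappa G A \<delta> = \<phi>"
    unfolding kappa_def M
  proof (rule the_equality, intro conjI ballI)
    fix \<psi> assume \<psi>: "\<psi> \<in> hom (presented_group ?X ?R) A \<and>
      \<psi> \<in> extensional (carrier (presented_group ?X ?R)) \<and>
      (\<forall>g\<in>carrier G. \<forall>h\<in>?H. \<psi> (wedge G ?H g h) = cocycle_hat G A \<delta> g h)"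
    show "\<psi> = \<phi>"
      using \<psi> \<phi> by (intro A.presented_hom_unique[of _ ?X ?R])
        (auto simp: wedge_def hat)
  qed (use \<phi> in \<open>auto simp: wedge_def hat\<close>)
  moreover have "\<phi> ` presented_gen ?X ?R ` ?X = {cocycle_alt g h | g h. g \<in> carrier G \<and> h \<in> ?H}"
  proof -
    have "\<phi> ` presented_gen ?X ?R ` ?X = (\<lambda>(g, h). cocycle_alt g h) ` ?X"
      unfolding image_image by (rule image_cong[OF _ \<phi>(3)]) simp_all
    then show ?thesis by auto
  qed
  ultimately show ?thesis
    by (simp add: M A.presented_hom_image[OF \<phi>(1)])
qed

section \<open>The lower central series of the extension from index \<open>c\<close> on\<close>

theorem theorem6:
  fixes G :: "('a, 'm) monoid_scheme"
    and A :: "('b, 'n) monoid_scheme"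
    and \<delta> :: "'a \<Rightarrow> 'a \<Rightarrow> 'b"
  assumes "nilpotent_group G" and "carrier G \<noteq> {\<one>\<^bsub>G\<^esub>}"
    and "comm_group A" and "carrier A \<noteq> {\<one>\<^bsub>A\<^esub>}"
    and "\<delta> \<in> cocycles2 G A"
  shows "lcs_extension (cocycle_extension G A \<delta>) (coefficient_image G A) \<longleftrightarrow>
    kappa G A \<delta> ` carrier (schur_multiplier_pair G (last_lcs_term G)) = carrier A"
proof -
  interpret A: comm_group A by fact
  interpret G: group G using assms(1) by (simp add: nilpotent_group_def)
  interpret cocycle_ext G A \<delta> by unfold_locales fact
  interpret proj: group_hom E G fst by (rule projection_hom)
  interpret coeff: group_hom A E "\<lambda>a. (\<one>\<^bsub>G\<^esub>, a)" by (rule coefficient_hom)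
  obtain c where \<lambda>: "last_lcs_term G = lower_central_series G c"
    and c: "lower_central_series G c \<noteq> {\<one>\<^bsub>G\<^esub>}" "lower_central_series G (Suc c) = {\<one>\<^bsub>G\<^esub>}"
    using nilpotent_last_lcs_term[OF assms(1,2)] .
  let ?H = "lower_central_series G c"
  have HG: "h \<in> carrier G" if "h \<in> ?H" for h
    using that G.lower_central_series_in_carrier by blast
  have comm: "g \<otimes>\<^bsub>G\<^esub> h = h \<otimes>\<^bsub>G\<^esub> g" if "g \<in> carrier G" "h \<in> ?H" for g h
  proof -
    \<comment> \<open>Centrality of the last non-trivial term: its commutators lie in the trivial
      next term.\<close>
    have "commutator G g h \<in> lower_central_series G (Suc c)"
      using that by (auto simp: commutator_subgroup_def intro: generate.incl)
    then show ?thesis using c(2) that HG by (simp add: G.commutator_eq_iff)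
  qed
  have sub: "subgroup ?H G"
  \<comment> \<open>Term 0 is the carrier, whereas every later term is a generated subgroup.\<close>
  proof (cases c)
    case (Suc n)
    then show ?thesis
      using G.lower_central_series_in_carrier[of n]
      by (auto simp: commutator_subgroup_def intro!: G.generate_is_subgroup G.commutator_closed)
  qed (simp add: G.subgroup_self)
  define S where "S = generate A {cocycle_alt g h | g h. g \<in> carrier G \<and> h \<in> ?H}"
  have kappa: "kappa G A \<delta> ` carrier (schur_multiplier_pair G (last_lcs_term G)) = S"
    using kappa_image sub comm unfolding \<lambda> S_def by blast
  have SA: "S \<subseteq> carrier A"
    unfolding S_def using HG by (intro A.generate_incl) (auto intro: cocycle_alt_closed)
  have proj: "fst ` lower_central_series E n = lower_central_series G n" for n
    by (rule proj.lower_central_series_image) (use A.one_closed in \<open>force simp: carrier_E\<close>)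
  have "{commutator E x z | x z. x \<in> carrier E \<and> z \<in> lower_central_series E c} =
      (\<lambda>a. (\<one>\<^bsub>G\<^esub>, a)) ` {cocycle_alt g h | g h. g \<in> carrier G \<and> h \<in> ?H}" (is "?L = ?R")
  proof
    have "commutator E x z = (\<one>\<^bsub>G\<^esub>, cocycle_alt (fst x) (fst z)) \<and> fst x \<in> carrier G \<and> fst z \<in> ?H"
      if "x \<in> carrier E" "z \<in> lower_central_series E c" for x z
      using that proj[of c] E.lower_central_series_in_carrier[of c]
        commutator_E[of "fst x" "fst z" "snd x" "snd z"] comm[of "fst x" "fst z"] HG[of "fst z"]
      by (force simp: carrier_E)
    then show "?L \<subseteq> ?R" by blast
  next
    show "?R \<subseteq> ?L"
    proof clarify
      fix g h assume gh: "g \<in> carrier G" "h \<in> ?H"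
      \<comment> \<open>The lift of \<open>h\<close> has to lie in the \<open>c\<close>-th term, so
        its coefficient \<open>b\<close> cannot be prescribed; the commutator does not depend on
        it.\<close>
      then obtain b where b: "(h, b) \<in> lower_central_series E c"
        using proj[of c] by force
      then have "b \<in> carrier A"
        using E.lower_central_series_in_carrier[of c] by (auto simp: carrier_E)
      then have "(\<one>\<^bsub>G\<^esub>, cocycle_alt g h) = commutator E (g, \<one>\<^bsub>A\<^esub>) (h, b)"
        using gh comm[OF gh] by (simp add: commutator_E HG)
      then show "\<exists>x z. (\<one>\<^bsub>G\<^esub>, cocycle_alt g h) = commutator E x z \<and> x \<in> carrier E \<and>
          z \<in> lower_central_series E c"
        using b gh by (force simp: carrier_E)
    qed
  qed
  \<comment> \<open>The coefficient embedding is a homomorphism, so it commutes with generating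
    subgroups.\<close>
  then have Suc_c: "lower_central_series E (Suc c) = (\<lambda>a. (\<one>\<^bsub>G\<^esub>, a)) ` S"
    unfolding S_def lower_central_series.simps commutator_subgroup_def
    by (subst coeff.generate_img[symmetric]) (auto intro: cocycle_alt_closed HG)
  have "commutator E x z = \<one>\<^bsub>E\<^esub>" if "x \<in> carrier E" "z \<in> lower_central_series E (Suc c)" for x z
    using that SA unfolding Suc_c by (auto simp: E.commutator_eq_iff coefficient_central)
  then have SSuc_c: "lower_central_series E (Suc (Suc c)) = {\<one>\<^bsub>E\<^esub>}"
    unfolding lower_central_series.simps(2)[of E "Suc c"] by (rule E.commutator_subgroup_eq_one)
  have nilpotent: "nilpotent_group E"
    using SSuc_c E.is_group unfolding nilpotent_group_def by blast
  have image: "coefficient_image G A = (\<lambda>a. (\<one>\<^bsub>G\<^esub>, a)) ` carrier A"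
    by (auto simp: coefficient_image_def)
  show ?thesis
  \<comment> \<open>The value of \<open>S\<close> decides whether the last non-trivial term of
    \<open>E\<close> has index \<open>c\<close> or \<open>Suc c\<close>.\<close>
  proof (cases "S = {\<one>\<^bsub>A\<^esub>}")
    case True
    have ne: "lower_central_series E c \<noteq> {\<one>\<^bsub>E\<^esub>}"
    proof
      assume "lower_central_series E c = {\<one>\<^bsub>E\<^esub>}"
      then have "lower_central_series G c = fst ` {\<one>\<^bsub>E\<^esub>}" by (simp only: proj[symmetric])
      then show False using c(1) by simp
    qed
    have "lower_central_series E (Suc c) = {\<one>\<^bsub>E\<^esub>}"
      unfolding Suc_c True by simp
    then have "is_last_lcs_term E (coefficient_image G A) \<longleftrightarrow>
        coefficient_image G A = lower_central_series E c"
      by (rule E.is_last_lcs_term_iff[OF ne])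
    \<comment> \<open>For trivial \<open>S\<close> both sides are false: the coefficient image
      projects to the unit but term \<open>c\<close> projects onto a non-trivial subgroup, and
      \<open>A\<close> is non-trivial, so \<open>S\<close> is not its carrier.\<close>
    moreover have "fst ` coefficient_image G A = {\<one>\<^bsub>G\<^esub>}"
      using A.one_closed unfolding image by force
    ultimately have "\<not> is_last_lcs_term E (coefficient_image G A)"
      using proj[of c] c(1) by metis
    then show ?thesis
      using assms(4) True by (simp add: kappa lcs_extension_def)
  next
    case False
    then have "lower_central_series E (Suc c) \<noteq> {\<one>\<^bsub>E\<^esub>}"
      \<comment> \<open>As a rewrite rule, \<open>coeff.hom_one\<close> would fold the pair of units
        back into the unit of \<open>E\<close> and undo \<open>one_E\<close>.\<close>
      unfolding Suc_c one_E by (auto simp del: coeff.hom_one)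
    then have "is_last_lcs_term E (coefficient_image G A) \<longleftrightarrow>
        coefficient_image G A = lower_central_series E (Suc c)"
      using SSuc_c by (rule E.is_last_lcs_term_iff)
    \<comment> \<open>The coefficient embedding is injective, so equal images mean equal
      sets.\<close>
    also have "\<dots> \<longleftrightarrow> S = carrier A"
      unfolding Suc_c image by auto
    finally show ?thesis
      using nilpotent by (simp add: kappa lcs_extension_def)
  qed
qed

end
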